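(* Let $n\ge 1$ and $m\ge 2$ be integers, and let $G$ be a finite region-connected $n$-simplex graph with chromatic number $\chi(G)=n+1$. Let $v=|V(G)|$ and let $r$ be the number of $n$-simplexes of $G$; let $R(G)$ denote the set of $n$-simplexes of $G$. Let $L_1,L_2:V(G)\to\mathbb{Z}_m$ be labelings. Call a function $k:R(G)\to\{0,1,\dots,m-1\}$ a solution if applying, for every $S\in R(G)$, the push $f_S$ exactly $k(S)$ times (in any order) transforms $L_1$ into $L_2$. If at least one solution exists, then the number of solutions is exactly $m^{\,r-v+n}$.
   Context: All graphs are finite simple graphs. An $n$-simplex of a graph $G$ is a set of $n+1$ vertices of $G$ that are pairwise adjacent. $G$ is an $n$-simplex graph if $G$ is a union of complete subgraphs on $n+1$ vertices (every vertex and every edge of $G$ lies in some $n$-simplex of $G$). Two $n$-simplexes $S,S'$ are adjacent if $|S\cap S'|=n$; $G$ is region-connected if for any two $n$-simplexes $S,S'$ there is a sequence $S=S_1,S_2,\dots,S_t=S'$ of $n$-simplexes with $S_j$ adjacent to $S_{j+1}$ for all $j$. A labeling is a map $L:V(G)\to\mathbb{Z}_m$. For an $n$-simplex $S$, the push $f_S$ sends a labeling $L$ to the labeling $L'$ with $L'(v)=L(v)+1 \pmod m$ for $v\in S$ and $L'(v)=L(v)$ for $v\notin S$. Pushes commute with one another and applying $f_S$ $m$ times is the identity. *)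

theory Defs
  imports Complex_Main "HOL-Library.FuncSet" "HOL-Library.Ramsey" "HOL-Library.Multiset"
begin

definition finite_simple_graph :: "'a set \<Rightarrow> 'a set set \<Rightarrow> bool" where
  "finite_simple_graph V E \<longleftrightarrow> finite V \<and> E \<subseteq> [V]\<^bsup>2\<^esup>"

definition proper_coloring :: "'a set \<Rightarrow> 'a set set \<Rightarrow> nat \<Rightarrow> ('a \<Rightarrow> nat) \<Rightarrow> bool" where
  "proper_coloring V E q c \<longleftrightarrow>
     c ` V \<subseteq> {..<q} \<and> (\<forall>u\<in>V. \<forall>w\<in>V. {u, w} \<in> E \<longrightarrow> c u \<noteq> c w)"

definition chromatic_number :: "'a set \<Rightarrow> 'a set set \<Rightarrow> nat" where
  "chromatic_number V E = (LEAST q. \<exists>c. proper_coloring V E q c)"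

definition simplexes :: "'a set \<Rightarrow> 'a set set \<Rightarrow> nat \<Rightarrow> 'a set set" where
  "simplexes V E n = {S \<in> [V]\<^bsup>(n + 1)\<^esup>. clique S E}"

definition simplex_graph :: "'a set \<Rightarrow> 'a set set \<Rightarrow> nat \<Rightarrow> bool" where
  "simplex_graph V E n \<longleftrightarrow>
     (\<forall>v\<in>V. \<exists>S\<in>simplexes V E n. v \<in> S) \<and>
     (\<forall>e\<in>E. \<exists>S\<in>simplexes V E n. e \<subseteq> S)"

definition adjacent_simplexes :: "nat \<Rightarrow> 'a set \<Rightarrow> 'a set \<Rightarrow> bool" where
  "adjacent_simplexes n S S' \<longleftrightarrow> card (S \<inter> S') = n"

definition region_connected :: "'a set \<Rightarrow> 'a set set \<Rightarrow> nat \<Rightarrow> bool" where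
  "region_connected V E n \<longleftrightarrow>
     (\<forall>S\<in>simplexes V E n. \<forall>S'\<in>simplexes V E n.
        \<exists>Ss. Ss \<noteq> [] \<and> set Ss \<subseteq> simplexes V E n \<and> hd Ss = S \<and> last Ss = S' \<and>
             successively (adjacent_simplexes n) Ss)"

text \<open>The group of integers modulo \<open>m\<close> is represented by the residues \<open>{..<m}\<close>.\<close>

definition labelings :: "'a set \<Rightarrow> nat \<Rightarrow> ('a \<Rightarrow> nat) set" where
  "labelings V m = V \<rightarrow>\<^sub>E {..<m}"

definition push :: "nat \<Rightarrow> 'a set \<Rightarrow> ('a \<Rightarrow> nat) \<Rightarrow> ('a \<Rightarrow> nat)" where
  "push m S L = (\<lambda>v. if v \<in> S then (L v + 1) mod m else L v)"

text \<open>The lists in \<open>push_orders R k\<close> are the possible orders in which to perform, for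
  each \<open>S \<in> R\<close>, the push at \<open>S\<close> exactly \<open>k S\<close> times.\<close>

definition push_orders :: "'a set set \<Rightarrow> ('a set \<Rightarrow> nat) \<Rightarrow> 'a set list set" where
  "push_orders R k = {Ss. set Ss \<subseteq> R \<and> (\<forall>S\<in>R. count_list Ss S = k S)}"

definition solutions ::
    "'a set \<Rightarrow> 'a set set \<Rightarrow> nat \<Rightarrow> nat \<Rightarrow> ('a \<Rightarrow> nat) \<Rightarrow> ('a \<Rightarrow> nat) \<Rightarrow> ('a set \<Rightarrow> nat) set" where
  "solutions V E n m L\<^sub>1 L\<^sub>2 =
     {k \<in> simplexes V E n \<rightarrow>\<^sub>E {..<m}.
        \<forall>Ss\<in>push_orders (simplexes V E n) k. fold (push m) Ss L\<^sub>1 = L\<^sub>2}"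

text \<open>The quantification over all orders in \<open>solutions\<close> is neither vacuous nor restrictive.\<close>

lemma push_orders_nonempty:
  assumes "finite R"
  shows "push_orders R k \<noteq> {}"
proof -
  define M where "M = (\<Sum>S\<in>R. replicate_mset (k S) S)"
  obtain Ss where Ss: "mset Ss = M"
    using ex_mset by blast
  have cnt: "count M T = (if T \<in> R then k T else 0)" for T
    using assms by (simp add: M_def count_sum)
  have "set Ss \<subseteq> R"
  proof
    fix T assume "T \<in> set Ss"
    then have "count M T \<noteq> 0"
      by (metis Ss count_eq_zero_iff set_mset_mset)
    then show "T \<in> R"
      using cnt by (metis (full_types))
  qed
  moreover have "\<forall>S\<in>R. count_list Ss S = k S"
    by (simp add: count_mset[symmetric] Ss cnt)
  ultimately show ?thesis
    unfolding push_orders_def by blast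
qed

lemma fold_push_order_irrelevant:
  assumes "Ss \<in> push_orders R k" and "Ts \<in> push_orders R k"
  shows "fold (push m) Ss L = fold (push m) Ts L"
proof -
  have "count (mset Ss) S = count (mset Ts) S" for S
  proof (cases "S \<in> R")
    case True
    then show ?thesis
      using assms by (simp add: push_orders_def count_mset)
  next
    case False
    then have "S \<notin> set Ss" "S \<notin> set Ts"
      using assms by (auto simp: push_orders_def)
    then show ?thesis
      by (metis count_eq_zero_iff set_mset_mset)
  qed
  then have "mset Ss = mset Ts"
    by (rule multiset_eqI)
  moreover have "push m S \<circ> push m T = push m T \<circ> push m S" for S T :: "'a set"
    by (auto simp: push_def fun_eq_iff)
  ultimately have "fold (push m) Ss = fold (push m) Ts"
    by (metis fold_multiset_equiv)
  then show ?thesis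
    by simp
qed

end

theory Submission
  imports Defs "HOL-Number_Theory.Cong"
begin

text \<open>Let \<open>\<phi>\<close> (\<open>weight\<close> below) send an integer weighting of the simplexes to the total weight
  received by each vertex. In an \<open>(n+1)\<close>-colouring every simplex has exactly one vertex of each colour, so all
  colour classes receive the same total. Fix a simplex \<open>S\<^sub>0\<close>, a vertex \<open>x\<^sub>0 \<in> S\<^sub>0\<close>, and put
  \<open>W = V - (S\<^sub>0 - {x\<^sub>0})\<close>, a set of \<open>v - n\<close> vertices. The class of \<open>x\<^sub>0\<close> lies in \<open>W\<close> and every
  other class has a single vertex outside \<open>W\<close>; hence if \<open>\<phi> d\<close> vanishes on \<open>W\<close> modulo \<open>m\<close>, it
  vanishes everywhere. Conversely \<open>\<phi>\<close> maps onto all functions on \<open>W\<close>: adjacent simplexes differ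
  by exchanging two vertices of equal colour, so by region-connectedness \<open>e\<^sub>u - e\<^sub>w\<close> is in the
  image whenever \<open>u\<close> and \<open>w\<close> have the same colour, and the indicator of \<open>S\<^sub>0\<close> restricts to
  \<open>e\<^bsub>x\<^sub>0\<^esub>\<close>. So the solutions form a fibre of a surjection from a set of
  size \<open>m ^ r\<close> to one of size \<open>m ^ (v - n)\<close> all of whose fibres are equinumerous.\<close>

section \<open>Weights modulo m and the size of their fibres\<close>

definition weight :: "'a set set \<Rightarrow> ('a set \<Rightarrow> int) \<Rightarrow> 'a \<Rightarrow> int" where
  "weight R k i = (\<Sum>S\<in>R. k S * of_bool (i \<in> S))"

lemma weight_add: "weight R (\<lambda>S. f S + g S) i = weight R f i + weight R g i"
  by (simp add: weight_def sum.distrib distrib_right)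

lemma weight_diff: "weight R (\<lambda>S. f S - g S) i = weight R f i - weight R g i"
  by (simp add: weight_def sum_subtractf left_diff_distrib)

lemma weight_linear_combination:
  "weight R (\<lambda>S. \<Sum>w\<in>W. a w * f w S) i = (\<Sum>w\<in>W. a w * weight R (f w) i)"
proof -
  have "weight R (\<lambda>S. \<Sum>w\<in>W. a w * f w S) i
      = (\<Sum>S\<in>R. \<Sum>w\<in>W. a w * (f w S * of_bool (i \<in> S)))"
    by (simp add: weight_def sum_distrib_right mult.assoc)
  also have "\<dots> = (\<Sum>w\<in>W. \<Sum>S\<in>R. a w * (f w S * of_bool (i \<in> S)))"
    by (rule sum.swap)
  finally show ?thesis
    by (simp add: weight_def sum_distrib_left)
qed

lemma weight_cong_mod:
  assumes "\<And>S. S \<in> R \<Longrightarrow> [f S = g S] (mod m)"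
  shows "[weight R f i = weight R g i] (mod m)"
  unfolding weight_def by (intro cong_sum cong_mult assms cong_refl)

lemma weight_single:
  assumes "finite R" "T \<in> R"
  shows "weight R (\<lambda>S. of_bool (S = T)) i = of_bool (i \<in> T)"
proof -
  have "weight R (\<lambda>S. of_bool (S = T)) i = (\<Sum>S\<in>R. if S = T then of_bool (i \<in> T) else 0)"
    unfolding weight_def by (intro sum.cong) auto
  also have "\<dots> = of_bool (i \<in> T)"
    using assms by simp
  finally show ?thesis .
qed

text \<open>The targets are integer-valued, so a difference of labels can serve as a target without
  being reduced to a residue.\<close>

definition weight_fibre :: "'a set set \<Rightarrow> nat \<Rightarrow> 'a set \<Rightarrow> ('a \<Rightarrow> int) \<Rightarrow> ('a set \<Rightarrow> nat) set" where
  "weight_fibre R m W t = {k \<in> R \<rightarrow>\<^sub>E {..<m}. \<forall>i\<in>W. [weight R (\<lambda>S. int (k S)) i = t i] (mod int m)}"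

lemma finite_weight_fibre:
  assumes "finite R"
  shows "finite (weight_fibre R m W t)"
  unfolding weight_fibre_def using assms by (simp add: finite_PiE)

text \<open>Translating every \<open>k\<close> by \<open>d\<close> and reducing modulo
  \<open>m\<close> is injective on residue-valued functions and shifts weights on \<open>W\<close>
  by \<open>t' - t\<close>.\<close>

lemma card_weight_fibre_le:
  assumes R: "finite R" and m: "m > 0"
    and d: "\<And>i. i \<in> W \<Longrightarrow> weight R d i = t' i - t i"
  shows "card (weight_fibre R m W t) \<le> card (weight_fibre R m W t')"
proof (rule card_inj_on_le)
  define h where "h k = (\<lambda>S\<in>R. nat ((int (k S) + d S) mod int m))" for k
  show "inj_on h (weight_fibre R m W t)"
  proof (rule inj_onI)
    fix k l assume k: "k \<in> weight_fibre R m W t" and l: "l \<in> weight_fibre R m W t"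
      and eq: "h k = h l"
    show "k = l"
    proof (rule PiE_ext)
      show "k \<in> R \<rightarrow>\<^sub>E {..<m}" "l \<in> R \<rightarrow>\<^sub>E {..<m}"
        using k l by (auto simp: weight_fibre_def)
      fix S assume S: "S \<in> R"
      have "nat ((int (k S) + d S) mod int m) = nat ((int (l S) + d S) mod int m)"
        using fun_cong[OF eq, of S] S by (simp add: h_def)
      then have "[int (k S) + d S = int (l S) + d S] (mod int m)"
        using m by (simp add: cong_def eq_nat_nat_iff)
      then have "[int (k S) = int (l S)] (mod int m)"
        by (simp add: cong_add_rcancel)
      moreover have "k S < m" "l S < m"
        using k l S by (auto simp: weight_fibre_def)
      ultimately show "k S = l S"
        by (simp add: cong_def)
    qed
  qed
  show "h ` weight_fibre R m W t \<subseteq> weight_fibre R m W t'"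
  proof (rule image_subsetI)
    fix k assume k: "k \<in> weight_fibre R m W t"
    have "h k \<in> R \<rightarrow>\<^sub>E {..<m}"
      using m by (auto simp: h_def nat_less_iff)
    moreover have "[weight R (\<lambda>S. int (h k S)) i = t' i] (mod int m)" if i: "i \<in> W" for i
    proof -
      have "[weight R (\<lambda>S. int (h k S)) i = weight R (\<lambda>S. int (k S) + d S) i] (mod int m)"
        using m by (intro weight_cong_mod) (simp add: h_def)
      also have "weight R (\<lambda>S. int (k S) + d S) i = weight R (\<lambda>S. int (k S)) i + (t' i - t i)"
        using d[OF i] by (simp add: weight_add)
      also have "[\<dots> = t i + (t' i - t i)] (mod int m)"
        using k i by (intro cong_add cong_refl) (auto simp: weight_fibre_def)
      finally show ?thesis by simp
    qed
    ultimately show "h k \<in> weight_fibre R m W t'"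
      by (simp add: weight_fibre_def)
  qed
  show "finite (weight_fibre R m W t')"
    using R by (rule finite_weight_fibre)
qed

text \<open>Linear combinations of the unit weightings realize every integer function on
  \<open>W\<close>, so translations in both directions make all fibres equinumerous. The
  \<open>m ^ card W\<close> fibres over residue-valued targets partition the
  \<open>m ^ card R\<close> weightings.\<close>

lemma card_weight_fibre:
  assumes R: "finite R" and W: "finite W" and m: "m > 0"
    and unit: "\<And>w. w \<in> W \<Longrightarrow> \<exists>K. \<forall>i\<in>W. weight R K i = of_bool (i = w)"
  shows "card (weight_fibre R m W t) * m ^ card W = m ^ card R"
proof -
  obtain K where K: "weight R (K w) i = of_bool (i = w)" if "w \<in> W" "i \<in> W" for w i
    using unit by metis
  have onto: "\<exists>d. \<forall>i\<in>W. weight R d i = a i" for a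
  proof (intro exI ballI)
    fix i assume i: "i \<in> W"
    have "weight R (\<lambda>S. \<Sum>w\<in>W. a w * K w S) i = (\<Sum>w\<in>W. a w * weight R (K w) i)"
      by (rule weight_linear_combination)
    also have "\<dots> = (\<Sum>w\<in>W. if i = w then a w else 0)"
      using i by (intro sum.cong) (auto simp: K)
    also have "\<dots> = a i"
      using i W by simp
    finally show "weight R (\<lambda>S. \<Sum>w\<in>W. a w * K w S) i = a i" .
  qed
  have le: "card (weight_fibre R m W s) \<le> card (weight_fibre R m W s')" for s s'
  proof -
    obtain d where "\<forall>i\<in>W. weight R d i = s' i - s i"
      using onto[of "\<lambda>i. s' i - s i"] by blast
    then show ?thesis
      using R m by (intro card_weight_fibre_le[of R m W d]) auto
  qed
  have eq: "card (weight_fibre R m W s) = card (weight_fibre R m W t)" for s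
    by (intro antisym le)
  define fib where "fib s = weight_fibre R m W (\<lambda>i. int (s i))" for s :: "'a \<Rightarrow> nat"
  have cover: "(R \<rightarrow>\<^sub>E {..<m}) = (\<Union>s\<in>W \<rightarrow>\<^sub>E {..<m}. fib s)"
  proof (intro equalityI subsetI)
    fix k assume k: "k \<in> R \<rightarrow>\<^sub>E {..<m}"
    \<comment> \<open>Each \<open>k\<close> lies in the fibre indexed by the residues of its own
      weight.\<close>
    define s where "s = (\<lambda>i\<in>W. nat (weight R (\<lambda>S. int (k S)) i mod int m))"
    have "s \<in> W \<rightarrow>\<^sub>E {..<m}"
      using m by (auto simp: s_def nat_less_iff)
    moreover have "k \<in> fib s"
      using k m by (simp add: fib_def weight_fibre_def s_def cong_def)
    ultimately show "k \<in> (\<Union>s\<in>W \<rightarrow>\<^sub>E {..<m}. fib s)"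
      by blast
  qed (auto simp: fib_def weight_fibre_def)
  have disjoint: "fib s \<inter> fib s' = {}"
    if s: "s \<in> W \<rightarrow>\<^sub>E {..<m}" and s': "s' \<in> W \<rightarrow>\<^sub>E {..<m}" and "s \<noteq> s'" for s s'
  proof (rule ccontr)
    assume "fib s \<inter> fib s' \<noteq> {}"
    then obtain k where k: "k \<in> fib s" "k \<in> fib s'"
      by blast
    have "s = s'"
    proof (rule PiE_ext[OF s s'])
      fix i assume i: "i \<in> W"
      then have "[int (s i) = int (s' i)] (mod int m)"
        using k unfolding fib_def weight_fibre_def by (blast intro: cong_trans cong_sym)
      moreover have "s i < m" "s' i < m"
        using s s' i by auto
      ultimately show "s i = s' i"
        by (simp add: cong_def)
    qed
    with \<open>s \<noteq> s'\<close> show False by simp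
  qed
  have "m ^ card R = card (R \<rightarrow>\<^sub>E {..<m})"
    using R by (simp add: card_PiE)
  also have "\<dots> = (\<Sum>s\<in>W \<rightarrow>\<^sub>E {..<m}. card (fib s))"
    unfolding cover using R W disjoint
    by (intro card_UN_disjoint) (auto simp: finite_PiE fib_def finite_weight_fibre)
  also have "\<dots> = (\<Sum>s\<in>W \<rightarrow>\<^sub>E {..<m}. card (weight_fibre R m W t))"
    unfolding fib_def by (intro sum.cong refl eq)
  also have "\<dots> = m ^ card W * card (weight_fibre R m W t)"
    using W by (simp add: card_PiE)
  finally show ?thesis
    by (simp add: mult.commute)
qed

section \<open>Pushes expressed by weights\<close>

lemma fold_push_apply:
  assumes "L i < m"
  shows "fold (push m) Ss L i = (L i + length (filter (\<lambda>S. i \<in> S) Ss)) mod m"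
  using assms
proof (induction Ss arbitrary: L)
  case (Cons S Ss)
  then have "push m S L i < m"
    by (auto simp: push_def)
  from Cons.IH[of "push m S L", OF this] show ?case
    by (simp add: push_def mod_simps)
\<comment> \<open>The empty list needs \<open>L i < m\<close>: no push has reduced the label, yet
  the right-hand side is reduced.\<close>
qed simp

lemma fold_push_outside:
  assumes "\<And>S. S \<in> set Ss \<Longrightarrow> i \<notin> S"
  shows "fold (push m) Ss L i = L i"
  using assms by (induction Ss arbitrary: L) (auto simp: push_def)

text \<open>Double counting: the list entries containing \<open>i\<close> are grouped by simplex,
  and \<open>S\<close> occurs \<open>k S\<close> times.\<close>

lemma length_filter_push_orders:
  assumes "finite R" "Ss \<in> push_orders R k"
  shows "int (length (filter (\<lambda>S. i \<in> S) Ss)) = weight R (\<lambda>S. int (k S)) i"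
proof -
  have "length (filter (\<lambda>S. i \<in> S) Ss) = sum_list (map (\<lambda>S. of_bool (i \<in> S)) Ss)"
    by (induction Ss) auto
  also have "\<dots> = (\<Sum>S\<in>R. count_list Ss S * of_bool (i \<in> S))"
    using assms by (intro sum_list_map_eq_sum_count2) (auto simp: push_orders_def)
  also have "\<dots> = (\<Sum>S\<in>R. k S * of_bool (i \<in> S))"
    using assms by (intro sum.cong) (auto simp: push_orders_def)
  finally show ?thesis
    by (simp add: weight_def)
qed

lemma finite_simplexes:
  assumes "finite V"
  shows "finite (simplexes V E n)"
  by (rule finite_subset[of _ "Pow V"]) (use assms in \<open>auto simp: simplexes_def nsets_def\<close>)

lemma simplexesD:
  assumes "S \<in> simplexes V E n"
  shows "S \<subseteq> V" "finite S" "card S = n + 1" "clique S E"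
  using assms by (auto simp: simplexes_def nsets_def)

lemma solutions_eq_weight_fibre:
  assumes V: "finite V" and L: "L\<^sub>1 \<in> labelings V m" "L\<^sub>2 \<in> labelings V m"
  shows "solutions V E n m L\<^sub>1 L\<^sub>2
    = weight_fibre (simplexes V E n) m V (\<lambda>i. int (L\<^sub>2 i) - int (L\<^sub>1 i))"
proof -
  let ?R = "simplexes V E n"
  have R: "finite ?R"
    using V by (rule finite_simplexes)
  have fold_iff: "fold (push m) Ss L\<^sub>1 = L\<^sub>2 \<longleftrightarrow>
      (\<forall>i\<in>V. [weight ?R (\<lambda>S. int (k S)) i = int (L\<^sub>2 i) - int (L\<^sub>1 i)] (mod int m))"
    if Ss: "Ss \<in> push_orders ?R k" for Ss k
  proof -
    \<comment> \<open>Outside \<open>V\<close> no simplex acts and both labelings take the value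
      \<open>undefined\<close>, so only vertices impose conditions.\<close>
    have "fold (push m) Ss L\<^sub>1 i = L\<^sub>2 i" if "i \<notin> V" for i
    proof -
      have "i \<notin> S" if "S \<in> set Ss" for S
        using that Ss \<open>i \<notin> V\<close> simplexesD(1)[of S V E n] by (auto simp: push_orders_def)
      moreover have "L\<^sub>1 i = L\<^sub>2 i"
        using PiE_arb[OF _ \<open>i \<notin> V\<close>] L unfolding labelings_def by metis
      ultimately show ?thesis
        by (simp add: fold_push_outside)
    qed
    then have "fold (push m) Ss L\<^sub>1 = L\<^sub>2 \<longleftrightarrow> (\<forall>i\<in>V. fold (push m) Ss L\<^sub>1 i = L\<^sub>2 i)"
      by (auto simp: fun_eq_iff)
    also have "\<dots> \<longleftrightarrow> (\<forall>i\<in>V. [weight ?R (\<lambda>S. int (k S)) i = int (L\<^sub>2 i) - int (L\<^sub>1 i)] (mod int m))"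
    proof (rule ball_cong[OF refl])
      fix i assume "i \<in> V"
      then have lt: "L\<^sub>1 i < m" "L\<^sub>2 i < m"
        using L by (auto simp: labelings_def)
      let ?l = "length (filter (\<lambda>S. i \<in> S) Ss)"
      have "fold (push m) Ss L\<^sub>1 i = L\<^sub>2 i \<longleftrightarrow> [L\<^sub>1 i + ?l = L\<^sub>2 i] (mod m)"
        using lt by (simp add: fold_push_apply cong_def)
      also have "\<dots> \<longleftrightarrow> [int (L\<^sub>1 i) + int ?l = int (L\<^sub>2 i)] (mod int m)"
        by (metis cong_int_iff of_nat_add)
      also have "\<dots> \<longleftrightarrow> [int ?l = int (L\<^sub>2 i) - int (L\<^sub>1 i)] (mod int m)"
        by (simp add: cong_iff_dvd_diff algebra_simps)
      finally show "fold (push m) Ss L\<^sub>1 i = L\<^sub>2 i \<longleftrightarrow>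
          [weight ?R (\<lambda>S. int (k S)) i = int (L\<^sub>2 i) - int (L\<^sub>1 i)] (mod int m)"
        by (simp add: length_filter_push_orders[OF R Ss])
    qed
    finally show ?thesis .
  qed
  \<comment> \<open>Every order gives the same congruences and at least one order exists, so the
    universal quantifier amounts to these congruences.\<close>
  have "(\<forall>Ss\<in>push_orders ?R k. fold (push m) Ss L\<^sub>1 = L\<^sub>2) \<longleftrightarrow>
      (\<forall>i\<in>V. [weight ?R (\<lambda>S. int (k S)) i = int (L\<^sub>2 i) - int (L\<^sub>1 i)] (mod int m))" for k
    using push_orders_nonempty[OF R, of k] fold_iff[of _ k] by blast
  then show ?thesis
    unfolding solutions_def weight_fibre_def by simp
qed

section \<open>Colourings, colour classes and the loss of n vertices\<close>

lemma proper_coloring_chromatic_number: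
  assumes "finite_simple_graph V E"
  shows "\<exists>c. proper_coloring V E (chromatic_number V E) c"
proof -
  have "finite V"
    using assms by (simp add: finite_simple_graph_def)
  then obtain c where c: "bij_betw c V {0..<card V}"
    using ex_bij_betw_finite_nat by blast
  \<comment> \<open>\<open>proper_coloring\<close> also ranges over \<open>u = w\<close>, so the
    absence of loops is needed before an injective numbering counts as proper.\<close>
  have "u \<noteq> w" if "{u, w} \<in> E" for u w
    using that assms by (auto simp: finite_simple_graph_def nsets_def)
  then have "proper_coloring V E (card V) c"
    using c unfolding proper_coloring_def by (auto simp: bij_betw_def dest: inj_onD)
  then show ?thesis
    unfolding chromatic_number_def by (intro LeastI_ex[of "\<lambda>q. Ex (proper_coloring V E q)"]) blast
qed

text \<open>Used to exclude an empty vertex set, so that a base simplex can be chosen.\<close>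

lemma chromatic_number_empty: "chromatic_number {} E = 0"
  by (simp add: chromatic_number_def proper_coloring_def)

lemma proper_coloring_inj_on_simplex:
  assumes "proper_coloring V E q c" "S \<in> simplexes V E n"
  shows "inj_on c S"
proof (rule inj_onI)
  fix u w assume uw: "u \<in> S" "w \<in> S" "c u = c w"
  show "u = w"
  proof (rule ccontr)
    assume "u \<noteq> w"
    then have "{u, w} \<in> E"
      using uw simplexesD(4)[OF assms(2)] by (auto simp: clique_def)
    then show False
      using uw simplexesD(1)[OF assms(2)] assms(1) by (auto simp: proper_coloring_def)
  qed
qed

lemma proper_coloring_image_simplex:
  assumes "proper_coloring V E (n + 1) c" "S \<in> simplexes V E n"
  shows "c ` S = {..<n + 1}"
proof (rule card_subset_eq)
  show "c ` S \<subseteq> {..<n + 1}"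
    using assms(1) simplexesD(1)[OF assms(2)] by (auto simp: proper_coloring_def)
  show "card (c ` S) = card {..<n + 1}"
    using card_image[OF proper_coloring_inj_on_simplex[OF assms]] simplexesD(3)[OF assms(2)]
    by simp
qed simp

text \<open>After exchanging the sums, each \<open>d S\<close> is counted once, at the only vertex
  of \<open>S\<close> with colour \<open>j\<close>. The total is therefore independent of
  \<open>j\<close>.\<close>

lemma weight_colour_class:
  assumes V: "finite V" and c: "proper_coloring V E (n + 1) c" and j: "j < n + 1"
  shows "(\<Sum>i\<in>{i \<in> V. c i = j}. weight (simplexes V E n) d i) = (\<Sum>S\<in>simplexes V E n. d S)"
proof -
  let ?R = "simplexes V E n" and ?C = "{i \<in> V. c i = j}"
  have "(\<Sum>i\<in>?C. weight ?R d i) = (\<Sum>S\<in>?R. \<Sum>i\<in>?C. d S * of_bool (i \<in> S))"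
    unfolding weight_def by (rule sum.swap)
  also have "\<dots> = (\<Sum>S\<in>?R. d S)"
  proof (rule sum.cong[OF refl])
    fix S assume S: "S \<in> ?R"
    have "j \<in> c ` S"
      using j proper_coloring_image_simplex[OF c S] by simp
    then obtain s where s: "s \<in> S" "c s = j"
      by auto
    have "s \<in> ?C"
      using s simplexesD(1)[OF S] by auto
    have "i \<in> S \<longleftrightarrow> i = s" if "i \<in> ?C" for i
      using that s inj_onD[OF proper_coloring_inj_on_simplex[OF c S]] by auto
    then have "(\<Sum>i\<in>?C. d S * of_bool (i \<in> S)) = (\<Sum>i\<in>?C. if i = s then d S else 0)"
      by (intro sum.cong) auto
    also have "\<dots> = d S"
      using V \<open>s \<in> ?C\<close> by simp
    finally show "(\<Sum>i\<in>?C. d S * of_bool (i \<in> S)) = d S" .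
  qed
  finally show ?thesis .
qed

lemma weight_vanishes_outside_simplex:
  assumes V: "finite V" and c: "proper_coloring V E (n + 1) c"
    and S\<^sub>0: "S\<^sub>0 \<in> simplexes V E n" "x\<^sub>0 \<in> S\<^sub>0"
    and zero: "\<And>i. i \<in> V - (S\<^sub>0 - {x\<^sub>0}) \<Longrightarrow> [weight (simplexes V E n) d i = 0] (mod m)"
    and s: "s \<in> V"
  shows "[weight (simplexes V E n) d s = 0] (mod m)"
proof (cases "s \<in> S\<^sub>0 - {x\<^sub>0}")
  case False
  then show ?thesis using zero s by blast
next
  case True
  let ?R = "simplexes V E n"
  let ?C = "\<lambda>x. {i \<in> V. c i = c x}"
  have x\<^sub>0: "x\<^sub>0 \<in> V"
    using S\<^sub>0 simplexesD(1) by blast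
  have colour: "c i < n + 1" if "i \<in> V" for i
    using that c by (auto simp: proper_coloring_def)
  \<comment> \<open>Other vertices with the colour of a vertex of \<open>S\<^sub>0\<close> avoid
    \<open>S\<^sub>0\<close>; hence their weights vanish by \<open>zero\<close>.\<close>
  have only: "i \<notin> S\<^sub>0" if "c i = c x" "i \<noteq> x" "x \<in> S\<^sub>0" for i x
    using that inj_onD[OF proper_coloring_inj_on_simplex[OF c S\<^sub>0(1)]] by blast
  have rest: "[(\<Sum>i\<in>?C x - {x}. weight ?R d i) = 0] (mod m)" if "x \<in> S\<^sub>0" for x
  proof -
    have "[(\<Sum>i\<in>?C x - {x}. weight ?R d i) = (\<Sum>i\<in>?C x - {x}. 0)] (mod m)"
      using only that by (intro cong_sum zero) auto
    then show ?thesis by simp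
  qed
  \<comment> \<open>The left side does not depend on \<open>x\<close>: the class of
    \<open>x\<^sub>0\<close> shows that it vanishes modulo \<open>m\<close>, and the class of
    \<open>s\<close> then isolates the weight at \<open>s\<close>.\<close>
  have split: "(\<Sum>S\<in>?R. d S) = weight ?R d x + (\<Sum>i\<in>?C x - {x}. weight ?R d i)"
    if "x \<in> V" for x
    using that V colour[OF that] weight_colour_class[OF V c, of "c x" d]
    by (subst sum.remove[of "?C x" x, symmetric]) auto
  have "[weight ?R d x\<^sub>0 = 0] (mod m)"
    using zero x\<^sub>0 by blast
  from cong_add[OF this rest[OF S\<^sub>0(2)]] have "[(\<Sum>S\<in>?R. d S) = 0] (mod m)"
    using split[OF x\<^sub>0] by simp
  moreover have "[(\<Sum>i\<in>?C s - {s}. weight ?R d i) = 0] (mod m)"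
    using True by (intro rest) simp
  ultimately have "[(\<Sum>S\<in>?R. d S) - (\<Sum>i\<in>?C s - {s}. weight ?R d i) = 0 - 0] (mod m)"
    by (rule cong_diff)
  then show ?thesis
    unfolding split[OF s] by simp
qed

section \<open>Vertex functions realized exactly over the integers\<close>

definition realizable :: "'a set \<Rightarrow> 'a set set \<Rightarrow> ('a \<Rightarrow> int) \<Rightarrow> bool" where
  "realizable V R x \<longleftrightarrow> (\<exists>K. \<forall>i\<in>V. weight R K i = x i)"

lemma realizable_zero: "realizable V R (\<lambda>i. 0)"
  unfolding realizable_def by (rule exI[of _ "\<lambda>_. 0"]) (simp add: weight_def)

lemma realizable_add:
  assumes "realizable V R x" "realizable V R y"
  shows "realizable V R (\<lambda>i. x i + y i)"
proof -
  obtain f g where "\<forall>i\<in>V. weight R f i = x i" "\<forall>i\<in>V. weight R g i = y i"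
    using assms unfolding realizable_def by blast
  then show ?thesis
    unfolding realizable_def by (intro exI[of _ "\<lambda>S. f S + g S"]) (simp add: weight_add)
qed

lemma realizable_diff:
  assumes "realizable V R x" "realizable V R y"
  shows "realizable V R (\<lambda>i. x i - y i)"
proof -
  obtain f g where "\<forall>i\<in>V. weight R f i = x i" "\<forall>i\<in>V. weight R g i = y i"
    using assms unfolding realizable_def by blast
  then show ?thesis
    unfolding realizable_def by (intro exI[of _ "\<lambda>S. f S - g S"]) (simp add: weight_diff)
qed

lemma realizable_indicator:
  assumes "finite R" "S \<in> R"
  shows "realizable V R (\<lambda>i. of_bool (i \<in> S))"
  using weight_single[OF assms] unfolding realizable_def by blast

text \<open>For \<open>u\<close> and \<open>u'\<close> distinct, equal colours keep each of them out
  of the other simplex. The \<open>n\<close> shared vertices then exhaust both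
  \<open>S - {u}\<close> and \<open>S' - {u'}\<close>, so the difference of the indicators of
  \<open>S\<close> and \<open>S'\<close> is the required function.\<close>

lemma realizable_exchange:
  assumes V: "finite V" and c: "proper_coloring V E (n + 1) c"
    and S: "S \<in> simplexes V E n" and S': "S' \<in> simplexes V E n"
    and adj: "adjacent_simplexes n S S'"
    and u: "u \<in> S" and u': "u' \<in> S'" and col: "c u = c u'"
  shows "realizable V (simplexes V E n) (\<lambda>i. of_bool (i = u) - of_bool (i = u'))"
proof (cases "u = u'")
  case True
  then show ?thesis by (simp add: realizable_zero)
next
  case False
  have "u' \<notin> S" "u \<notin> S'"
    using False u u' col inj_onD[OF proper_coloring_inj_on_simplex[OF c S]]
      inj_onD[OF proper_coloring_inj_on_simplex[OF c S']] by metis+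
  have "S \<inter> S' = S - {u}"
    using \<open>u \<notin> S'\<close> adj u simplexesD[OF S]
    by (intro card_subset_eq) (auto simp: adjacent_simplexes_def)
  moreover have "S \<inter> S' = S' - {u'}"
    using \<open>u' \<notin> S\<close> adj u' simplexesD[OF S']
    by (intro card_subset_eq) (auto simp: adjacent_simplexes_def)
  ultimately have "(\<lambda>i. of_bool (i = u) - of_bool (i = u') :: int)
      = (\<lambda>i. of_bool (i \<in> S) - of_bool (i \<in> S'))"
    using u u' \<open>u' \<notin> S\<close> \<open>u \<notin> S'\<close> by (intro ext) (auto simp: of_bool_def)
  moreover have "realizable V (simplexes V E n) (\<lambda>i. of_bool (i \<in> S) - of_bool (i \<in> S'))"
    using S S' finite_simplexes[OF V] by (intro realizable_diff realizable_indicator)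
  ultimately show ?thesis by simp
qed

text \<open>The colour of \<open>u\<close> is followed through the chain: every simplex has a vertex
  of that colour, and the exchanges between consecutive ones telescope. In the last simplex that
  vertex can only be \<open>w\<close>.\<close>

lemma realizable_along_chain:
  assumes V: "finite V" and c: "proper_coloring V E (n + 1) c"
    and "Ss \<noteq> []" "set Ss \<subseteq> simplexes V E n" "successively (adjacent_simplexes n) Ss"
    and "u \<in> hd Ss" "w \<in> last Ss" "c u = c w"
  shows "realizable V (simplexes V E n) (\<lambda>i. of_bool (i = u) - of_bool (i = w))"
  using assms(3-)
proof (induction Ss arbitrary: u rule: induct_list012)
  case (2 S)
  then have "u = w"
    using inj_onD[OF proper_coloring_inj_on_simplex[OF c, of S]] by auto
  then show ?case by (simp add: realizable_zero)
next
  case (3 S S' Ss)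
  then have S: "S \<in> simplexes V E n" and S': "S' \<in> simplexes V E n"
    by auto
  have u: "u \<in> S"
    using 3 by simp
  then have "c u \<in> c ` S'"
    using proper_coloring_image_simplex[OF c] S S' by blast
  then obtain u' where u': "u' \<in> S'" "c u = c u'"
    by auto
  have "realizable V (simplexes V E n) (\<lambda>i. of_bool (i = u) - of_bool (i = u'))"
    using 3 u' by (intro realizable_exchange[OF V c S S' _ u]) auto
  moreover have "realizable V (simplexes V E n) (\<lambda>i. of_bool (i = u') - of_bool (i = w))"
    using 3 u' by (intro "3.IH"(2)) auto
  ultimately have "realizable V (simplexes V E n)
      (\<lambda>i. (of_bool (i = u) - of_bool (i = u')) + (of_bool (i = u') - of_bool (i = w)))"
    by (rule realizable_add)
  then show ?case by simp
qed simp

lemma realizable_same_colour: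
  assumes V: "finite V" and "simplex_graph V E n" "region_connected V E n"
    and c: "proper_coloring V E (n + 1) c" and "u \<in> V" "w \<in> V" "c u = c w"
  shows "realizable V (simplexes V E n) (\<lambda>i. of_bool (i = u) - of_bool (i = w))"
proof -
  obtain S S' where S: "S \<in> simplexes V E n" "u \<in> S" and S': "S' \<in> simplexes V E n" "w \<in> S'"
    using assms unfolding simplex_graph_def by meson
  obtain Ss where "Ss \<noteq> []" "set Ss \<subseteq> simplexes V E n" "hd Ss = S" "last Ss = S'"
    "successively (adjacent_simplexes n) Ss"
    using assms(3) S(1) S'(1) unfolding region_connected_def by meson
  with S S' \<open>c u = c w\<close> show ?thesis
    using realizable_along_chain[OF V c, of Ss u w] by blast
qed

section \<open>Counting the solutions\<close>

theorem theorem4p6p10: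
  fixes V :: "'a set" and E :: "'a set set" and n m v r :: nat
    and L\<^sub>1 L\<^sub>2 :: "'a \<Rightarrow> nat"
  assumes "n \<ge> 1" and "m \<ge> 2"
    and "finite_simple_graph V E"
    and "simplex_graph V E n"
    and "region_connected V E n"
    and "chromatic_number V E = n + 1"
    and "v = card V" and "r = card (simplexes V E n)"
    and "L\<^sub>1 \<in> labelings V m" and "L\<^sub>2 \<in> labelings V m"
    and "solutions V E n m L\<^sub>1 L\<^sub>2 \<noteq> {}"
  shows "real (card (solutions V E n m L\<^sub>1 L\<^sub>2)) = real m powi (int r - int v + int n)"
proof -
  let ?R = "simplexes V E n" and ?t = "\<lambda>i. int (L\<^sub>2 i) - int (L\<^sub>1 i)"
  have V: "finite V"
    using assms(3) by (simp add: finite_simple_graph_def)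
  obtain c where c: "proper_coloring V E (n + 1) c"
    using proper_coloring_chromatic_number[OF assms(3)] assms(6) by auto
  have "V \<noteq> {}"
    using assms(6) chromatic_number_empty[of E] by auto
  then obtain S\<^sub>0 where S\<^sub>0: "S\<^sub>0 \<in> ?R"
    using assms(4) unfolding simplex_graph_def by blast
  obtain x\<^sub>0 where x\<^sub>0: "x\<^sub>0 \<in> S\<^sub>0"
    using simplexesD(3)[OF S\<^sub>0] by fastforce
  note S\<^sub>0D = simplexesD[OF S\<^sub>0]
  define W where "W = V - (S\<^sub>0 - {x\<^sub>0})"
  have WV: "W \<subseteq> V"
    by (auto simp: W_def)
  have cardW: "card W + n = v"
  proof -
    have "card (S\<^sub>0 - {x\<^sub>0}) = n"
      using S\<^sub>0D x\<^sub>0 by simp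
    moreover have "card W = card V - card (S\<^sub>0 - {x\<^sub>0})"
      unfolding W_def using S\<^sub>0D by (intro card_Diff_subset) auto
    moreover have "card (S\<^sub>0 - {x\<^sub>0}) \<le> card V"
      using S\<^sub>0D V by (intro card_mono) auto
    ultimately show ?thesis
      using assms(7) by simp
  qed
  have unit: "\<exists>K. \<forall>i\<in>W. weight ?R K i = of_bool (i = w)" if w: "w \<in> W" for w
  proof -
    have "c w \<in> c ` S\<^sub>0"
      using w WV c proper_coloring_image_simplex[OF c S\<^sub>0] by (auto simp: proper_coloring_def)
    then obtain s where s: "s \<in> S\<^sub>0" "c w = c s"
      by auto
    have d: "realizable V ?R (\<lambda>i. of_bool (i = w) - of_bool (i = s))"
      using w WV s S\<^sub>0D by (intro realizable_same_colour[OF V assms(4,5) c]) auto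
    show ?thesis
    \<comment> \<open>The unwanted term at \<open>s\<close> must disappear on \<open>W\<close>. If
      \<open>s = x\<^sub>0\<close>, the indicator of \<open>S\<^sub>0\<close> cancels it, since
      \<open>S\<^sub>0\<close> meets \<open>W\<close> only in \<open>x\<^sub>0\<close>; otherwise
      \<open>s\<close> lies outside \<open>W\<close>.\<close>
    proof (cases "s = x\<^sub>0")
      case True
      from realizable_add[OF d realizable_indicator[OF finite_simplexes[OF V] S\<^sub>0]]
      obtain K where K: "\<forall>i\<in>V. weight ?R K i = of_bool (i = w) - of_bool (i = s) + of_bool (i \<in> S\<^sub>0)"
        unfolding realizable_def by blast
      have "i \<in> S\<^sub>0 \<longleftrightarrow> i = s" if "i \<in> W" for i
        using that True x\<^sub>0 by (auto simp: W_def)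
      with K WV show ?thesis
        by (intro exI[of _ K]) auto
    next
      case False
      then have "s \<notin> W"
        using s by (auto simp: W_def)
      moreover obtain K where "\<forall>i\<in>V. weight ?R K i = of_bool (i = w) - of_bool (i = s)"
        using d unfolding realizable_def by blast
      ultimately show ?thesis
        using WV by (intro exI[of _ K]) auto
    qed
  qed
  have sol: "solutions V E n m L\<^sub>1 L\<^sub>2 = weight_fibre ?R m V ?t"
    using V assms(9,10) by (rule solutions_eq_weight_fibre)
  also have "\<dots> = weight_fibre ?R m W ?t"
  proof
    show "weight_fibre ?R m V ?t \<subseteq> weight_fibre ?R m W ?t"
      using WV by (auto simp: weight_fibre_def)
    \<comment> \<open>A solution \<open>k\<^sub>0\<close> is the reference point: if
      \<open>k\<close> fits the target on \<open>W\<close>, then \<open>k - k\<^sub>0\<close> has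
      weight zero there modulo \<open>m\<close>, hence on all of \<open>V\<close>. Adding the
      congruences of \<open>k\<^sub>0\<close> back gives those of \<open>k\<close>.\<close>
    obtain k\<^sub>0 where k\<^sub>0: "k\<^sub>0 \<in> weight_fibre ?R m V ?t"
      using assms(11) sol by blast
    show "weight_fibre ?R m W ?t \<subseteq> weight_fibre ?R m V ?t"
    proof
      fix k assume k: "k \<in> weight_fibre ?R m W ?t"
      have eq: "[weight ?R (\<lambda>S. int (k\<^sub>0 S)) i = ?t i] (mod int m)" if "i \<in> V" for i
        using k\<^sub>0 that by (simp add: weight_fibre_def)
      have "[weight ?R (\<lambda>S. int (k S) - int (k\<^sub>0 S)) i = 0] (mod int m)" if i: "i \<in> W" for i
      proof -
        have "[weight ?R (\<lambda>S. int (k S)) i = ?t i] (mod int m)"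
          using k i by (simp add: weight_fibre_def)
        from cong_diff[OF this eq[of i]] show ?thesis
          using i WV by (auto simp: weight_diff)
      qed
      then have "[weight ?R (\<lambda>S. int (k S) - int (k\<^sub>0 S)) i = 0] (mod int m)" if "i \<in> V" for i
        using weight_vanishes_outside_simplex[OF V c S\<^sub>0 x\<^sub>0 _ that] unfolding W_def by blast
      from cong_add[OF this eq] have "[weight ?R (\<lambda>S. int (k S)) i = ?t i] (mod int m)"
        if "i \<in> V" for i
        using that by (fastforce simp: weight_diff)
      then show "k \<in> weight_fibre ?R m V ?t"
        using k by (simp add: weight_fibre_def)
    qed
  qed
  finally have "card (solutions V E n m L\<^sub>1 L\<^sub>2) * m ^ card W = m ^ r"
    using card_weight_fibre[OF finite_simplexes[OF V] finite_subset[OF WV V] _ unit, of m ?t]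
      assms(2,8) by simp
  \<comment> \<open>Over the reals the factor \<open>m ^ card W\<close> can be divided out, and
    \<open>powi\<close> takes the integer difference of exponents without truncated
    subtraction.\<close>
  then have "real (card (solutions V E n m L\<^sub>1 L\<^sub>2)) * real m ^ card W = real m ^ r"
    by (metis of_nat_mult of_nat_power)
  then have "real (card (solutions V E n m L\<^sub>1 L\<^sub>2)) = real m ^ r / real m ^ card W"
    using assms(2) by (simp add: field_simps)
  also have "\<dots> = real m powi (int r - int (card W))"
    using assms(2) by (simp add: power_int_diff)
  also have "int r - int (card W) = int r - int v + int n"
    using cardW by simp
  finally show ?thesis .
qed

end
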